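(* Let $m>0$, $n_{\rm el}>0$, $\eta>0$ with $\eta\neq1$, and $\zeta\in(0,1]$. Let $\tilde v:\mathbb{R}^2\setminus\{0\}\to\mathbb{R}$ be a measurable function (of arbitrary sign) that is $C_4$ symmetric ($\tilde v(C_4\mathbf q)=\tilde v(\mathbf q)$ for all $\mathbf q$), not almost everywhere zero, and such that the integrals defining the second-order ring energies per unit area $E_{\mathbf b}^{\rm pVP}[\zeta]/A$ and $E_{\mathbf b}^{\rm pSP}[\zeta]/A$ of the partially valley-polarized and partially spin-polarized states are finite. Then $$\frac{E_{\mathbf b}^{\rm pVP}[\zeta]}{A}<\frac{E_{\mathbf b}^{\rm pSP}[\zeta]}{A}.$$
   Context: Units with $\hbar=1$. $C_4$ is the rotation by $\pi/2$: $C_4(q_x,q_y)=(-q_y,q_x)$. The function $\tilde v$ plays the role of the Fourier transform of the two-body interaction potential. There are four electron flavors $\alpha=1,2,3,4$, standing for (spin, valley) $=(\uparrow,X),(\downarrow,X),(\uparrow,Y),(\downarrow,Y)$, with mass anisotropies $\eta_1=\eta_2=\eta$ and $\eta_3=\eta_4=1/\eta$, and dispersions $$\epsilon_\alpha(\mathbf q)=\frac{q_x^2/\sqrt{\eta_\alpha}+q_y^2\sqrt{\eta_\alpha}}{2m}.$$ The flavor densities are $n_\alpha=\nu_\alpha n_{\rm el}$ with $\nu_\alpha\ge0$, $\sum_\alpha\nu_\alpha=1$. The non-interacting Lindhard function (summed over flavors) at imaginary frequency $i\Omega$, $\Omega>0$, is $$\Pi(i\Omega,\mathbf q)=\frac{m}{2\pi}\sum_{\alpha=1}^4\left(1-\operatorname{Re}\sqrt{\Big(1+\frac{i\Omega}{\epsilon_\alpha(\mathbf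 q)}\Big)^2-\frac{8\pi n_\alpha}{m\,\epsilon_\alpha(\mathbf q)}}\right),$$ with the principal square root (nonnegative real part). The second-order ring-diagram contribution to the ground-state energy per unit area (the only second-order contribution that differs between the valley- and spin-polarized states) is $$\frac{E_{\mathbf b}}{A}=-\frac12\int_0^\infty\frac{d\Omega}{2\pi}\int_{\mathbb{R}^2}\frac{d^2\mathbf q}{(2\pi)^2}\,[\tilde v(\mathbf q)]^2\,[\Pi(i\Omega,\mathbf q)]^2.$$ $E_{\mathbf b}^{\rm pVP}[\zeta]$ is this quantity for $(\nu_1,\nu_2,\nu_3,\nu_4)=\big(\tfrac{1+\zeta}{4},\tfrac{1+\zeta}{4},\tfrac{1-\zeta}{4},\tfrac{1-\zeta}{4}\big)$ (partial valley polarization $\zeta$; $\zeta=1$ is the fully valley-polarized state), and $E_{\mathbf b}^{\rm pSP}[\zeta]$ is this quantity for $(\nu_1,\nu_2,\nu_3,\nu_4)=\big(\tfrac{1+\zeta}{4},\tfrac{1-\zeta}{4},\tfrac{1+\zeta}{4},\tfrac{1-\zeta}{4}\big)$ (partial spin polarization $\zeta$; $\zeta=1$ is the fully spin-polarized state). *)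

theory Defs
  imports "HOL-Analysis.Analysis"
begin

definition C4 :: "real \<times> real \<Rightarrow> real \<times> real" where
  "C4 q = (- snd q, fst q)"

text \<open>Flavors are the indices 1, 2, 3, 4, standing for (spin, valley) = (up, X), (down, X),
  (up, Y), (down, Y).\<close>

definition anisotropy :: "real \<Rightarrow> nat \<Rightarrow> real" where
  "anisotropy \<eta> \<alpha> = (if \<alpha> \<in> {1, 2} then \<eta> else 1 / \<eta>)"

definition dispersion :: "real \<Rightarrow> real \<Rightarrow> nat \<Rightarrow> real \<times> real \<Rightarrow> real" where
  "dispersion m \<eta> \<alpha> q =
     ((fst q)\<^sup>2 / sqrt (anisotropy \<eta> \<alpha>) + (snd q)\<^sup>2 * sqrt (anisotropy \<eta> \<alpha>)) / (2 * m)"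

text \<open>The Lindhard function at imaginary frequency; \<open>\<nu> \<alpha>\<close> is the fraction of the total density
  \<open>n\<close> carried by flavor \<open>\<alpha>\<close>. At \<open>q = 0\<close> the value is an irrelevant artefact of division by zero.\<close>

definition lindhard ::
    "real \<Rightarrow> real \<Rightarrow> real \<Rightarrow> (nat \<Rightarrow> real) \<Rightarrow> real \<Rightarrow> real \<times> real \<Rightarrow> real" where
  "lindhard m n \<eta> \<nu> \<Omega> q =
     m / (2 * pi) *
     (\<Sum>\<alpha>=1..4. 1 - Re (csqrt ((1 + \<i> * of_real (\<Omega> / dispersion m \<eta> \<alpha> q))\<^sup>2
                          - of_real (8 * pi * (\<nu> \<alpha> * n) / (m * dispersion m \<eta> \<alpha> q)))))"

text \<open>The integrand of the ring diagram is nonnegative, so its integral always exists in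
  \<open>[0, \<infinity>]\<close>. Lebesgue (rather than Borel) measure is used in momentum space so that the
  potential may be any Lebesgue measurable function.\<close>

definition ring_integral ::
    "real \<Rightarrow> real \<Rightarrow> real \<Rightarrow> (real \<times> real \<Rightarrow> real) \<Rightarrow> (nat \<Rightarrow> real) \<Rightarrow> ennreal" where
  "ring_integral m n \<eta> v \<nu> =
     (\<integral>\<^sup>+\<Omega>\<in>{0<..}. (\<integral>\<^sup>+q. ennreal ((v q)\<^sup>2 * (lindhard m n \<eta> \<nu> \<Omega> q)\<^sup>2) \<partial>lebesgue) \<partial>lborel)"

text \<open>Second-order ring energy per unit area, meaningful when \<open>ring_integral\<close> is finite.\<close>

definition ring_energy ::
    "real \<Rightarrow> real \<Rightarrow> real \<Rightarrow> (real \<times> real \<Rightarrow> real) \<Rightarrow> (nat \<Rightarrow> real) \<Rightarrow> real" where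
  "ring_energy m n \<eta> v \<nu> =
     - (1 / 2) * (1 / (2 * pi)) * (1 / (2 * pi)\<^sup>2) * enn2real (ring_integral m n \<eta> v \<nu>)"

definition pVP :: "real \<Rightarrow> nat \<Rightarrow> real" where
  "pVP \<zeta> \<alpha> = (if \<alpha> \<in> {1, 2} then (1 + \<zeta>) / 4 else (1 - \<zeta>) / 4)"

definition pSP :: "real \<Rightarrow> nat \<Rightarrow> real" where
  "pSP \<zeta> \<alpha> = (if \<alpha> \<in> {1, 3} then (1 + \<zeta>) / 4 else (1 - \<zeta>) / 4)"

end

theory Submission
  imports Defs "HOL-Real_Asymp.Real_Asymp"
begin

text \<open>Write \<open>P\<close> for the Lindhard function of the valley-polarized state and \<open>Q = P \<circ> C\<^sub>4\<close>. Rotating by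
  \<open>C\<^sub>4\<close> exchanges the two valleys, so the Lindhard function of the spin-polarized state is
  \<open>(P + Q) / 2\<close>. Since \<open>\<integral> v\<^sup>2 P\<^sup>2 = \<integral> v\<^sup>2 Q\<^sup>2\<close>, the parallelogram identity shows that the two ring
  integrals differ by \<open>\<integral> v\<^sup>2 ((P - Q) / 2)\<^sup>2\<close>. This is positive because, as \<open>\<Omega> \<rightarrow> \<infinity>\<close>, each flavor
  contributes \<open>c \<epsilon> / (2 \<Omega>\<^sup>2)\<close> to leading order, with \<open>c\<close> proportional to its density, and hence
  \<open>P \<noteq> Q\<close> for all large \<open>\<Omega>\<close> as soon as the dispersions of the two valleys differ at \<open>q\<close>, which
  happens off the diagonals \<open>q\<^sub>x\<^sup>2 = q\<^sub>y\<^sup>2\<close>.\<close>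

section \<open>Large-frequency behaviour of a single flavor\<close>

text \<open>The summand of the Lindhard function for one flavor, with \<open>a\<close> its
  dispersion at the given momentum, \<open>s\<close> the frequency and \<open>c\<close> equal to 8
  pi / m times the flavor density.\<close>

definition polarization :: "real \<Rightarrow> real \<Rightarrow> real \<Rightarrow> real" where
  "polarization c a s = 1 - Re (csqrt ((1 + \<i> * of_real (s / a))\<^sup>2 - of_real (c / a)))"

lemma polarization_eq:
  "polarization c a s =
     1 - sqrt ((sqrt ((1 - (s / a)\<^sup>2 - c / a)\<^sup>2 + (2 * (s / a))\<^sup>2) + (1 - (s / a)\<^sup>2 - c / a)) / 2)"
proof -
  have "(1 + \<i> * of_real (s / a))\<^sup>2 - of_real (c / a)
      = Complex (1 - (s / a)\<^sup>2 - c / a) (2 * (s / a))"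
    by (simp add: complex_eq_iff power2_eq_square)
  then show ?thesis
    unfolding polarization_def by (simp add: cmod_def)
qed

lemma polarization_measurable [measurable]:
  assumes [measurable]: "a \<in> borel_measurable M" "s \<in> borel_measurable M"
  shows "(\<lambda>x. polarization c (a x) (s x)) \<in> borel_measurable M"
  unfolding polarization_eq by measurable

text \<open>Multiplying by the conjugate removes the cancellation between the two large terms on the
  left, which leaves a form suited to an expansion at large \<open>t\<close>. The second assumption
  keeps the denominator positive.\<close>

lemma rationalised_sqrt:
  fixes t d :: real
  assumes "t > 0" and d: "t + d > 1"
  shows "(sqrt ((1 - t - d)\<^sup>2 + (2 * sqrt t)\<^sup>2) + (1 - t - d)) / 2
    = 2 * t / (sqrt ((t + 1 + d)\<^sup>2 - 4 * d) + t + d - 1)"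
proof -
  have eq: "(1 - t - d)\<^sup>2 + (2 * sqrt t)\<^sup>2 = (t + 1 + d)\<^sup>2 - 4 * d"
    using assms by (simp add: power2_eq_square algebra_simps)
  define r where "r = sqrt ((t + 1 + d)\<^sup>2 - 4 * d)"
  have "r\<^sup>2 = (1 - t - d)\<^sup>2 + 4 * t"
    unfolding r_def eq[symmetric] using assms by simp
  moreover have "r \<ge> 0"
    unfolding r_def eq[symmetric] by simp
  ultimately have "(r + (1 - t - d)) / 2 = 2 * t / (r + t + d - 1)"
    using assms by (simp add: divide_simps) (simp add: power2_eq_square algebra_simps)
  then show ?thesis
    unfolding eq r_def .
qed

text \<open>With \<open>t = (s / a)\<^sup>2\<close> and \<open>d = c / a\<close>, the rationalised
  square root is 1 - d / (2 t) to first order in 1 / t.\<close>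

lemma tendsto_scaled_polarization:
  assumes "a > 0"
  shows "((\<lambda>s. s\<^sup>2 * polarization c a s) \<longlongrightarrow> c * a / 2) at_top"
proof -
  define d where "d = c / a"
  let ?f = "\<lambda>t. t * (1 - sqrt (2 * t / (sqrt ((t + 1 + d)\<^sup>2 - 4 * d) + t + d - 1)))"
  have "(?f \<longlongrightarrow> d / 2) at_top"
    by real_asymp (simp add: field_simps)
  moreover have "filterlim (\<lambda>s. (s / a)\<^sup>2) at_top at_top"
    using assms by real_asymp
  ultimately have "((\<lambda>s. ?f ((s / a)\<^sup>2)) \<longlongrightarrow> d / 2) at_top"
    by (rule filterlim_compose)
  then have "((\<lambda>s. a\<^sup>2 * ?f ((s / a)\<^sup>2)) \<longlongrightarrow> a\<^sup>2 * (d / 2)) at_top"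
    by (intro tendsto_intros)
  moreover have "a\<^sup>2 * (d / 2) = c * a / 2"
    using assms by (simp add: d_def power2_eq_square)
  moreover have "eventually (\<lambda>s. (s / a)\<^sup>2 + d > 1) at_top"
    using assms by real_asymp
  then have "eventually (\<lambda>s. a\<^sup>2 * ?f ((s / a)\<^sup>2) = s\<^sup>2 * polarization c a s) at_top"
    using eventually_gt_at_top[of 0]
  proof eventually_elim
    case (elim s)
    have "sqrt ((s / a)\<^sup>2) = s / a"
      using elim assms by simp
    then have "polarization c a s
        = 1 - sqrt (2 * (s / a)\<^sup>2 / (sqrt (((s / a)\<^sup>2 + 1 + d)\<^sup>2 - 4 * d) + (s / a)\<^sup>2 + d - 1))"
      using rationalised_sqrt[of "(s / a)\<^sup>2" d] elim assms
      unfolding polarization_eq d_def[symmetric] by (metis zero_less_divide_iff zero_less_power)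
    then show ?case
      using assms by (simp add: power_divide)
  qed
  ultimately show ?thesis
    using tendsto_cong by force
qed

section \<open>Lebesgue measure on the plane: rotation invariance and null diagonals\<close>

lemma C4_measurable [measurable]: "C4 \<in> borel \<rightarrow>\<^sub>M borel"
  unfolding C4_def by (intro borel_measurable_continuous_onI continuous_intros)

text \<open>Lebesgue measure is determined by its values on boxes, and the rotation only swaps the
  side lengths of a box.\<close>

lemma lborel_distr_C4: "distr lborel borel C4 = (lborel :: (real \<times> real) measure)"
proof (rule lborel_eqI[symmetric])
  fix l u :: "real \<times> real"
  assume le: "\<And>b. b \<in> Basis \<Longrightarrow> l \<bullet> b \<le> u \<bullet> b"
  obtain a b c d where lu: "l = (a, b)" "u = (c, d)" by (metis surj_pair)
  have ac: "a \<le> c" "b \<le> d"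
    using le[of "(1, 0)"] le[of "(0, 1)"] by (auto simp: lu Basis_prod_def)
  have "C4 -` box l u = box (b, - c) (d, - a)"
    by (auto simp: C4_def lu box_def Basis_prod_def)
  then have "emeasure (distr lborel borel C4) (box l u) = emeasure lborel (box (b, - c) (d, - a))"
    by (simp add: emeasure_distr)
  also have "\<dots> = (\<Prod>b\<in>Basis. (u - l) \<bullet> b)"
    using ac unfolding lu
    by (subst emeasure_lborel_box) (auto simp: Basis_prod_def prod.insert_if ennreal_mult[symmetric] mult.commute)
  finally show "emeasure (distr lborel borel C4) (box l u) = (\<Prod>b\<in>Basis. (u - l) \<bullet> b)" .
qed simp

lemma AE_lborel_C4:
  assumes "AE q in lborel. p q"
  shows "AE q in lborel. p (C4 q)"
proof -
  have "C4 \<in> lborel \<rightarrow>\<^sub>M borel"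
    by simp
  then show ?thesis
    using assms by (subst (asm) lborel_distr_C4[symmetric]) (rule AE_distrD)
qed

text \<open>The diagonals are two lines through the origin. Avoiding them also avoids the origin,
  where nothing is assumed about the potential.\<close>

lemma AE_lborel_off_diagonals: "AE q :: real \<times> real in lborel. (fst q)\<^sup>2 \<noteq> (snd q)\<^sup>2"
proof -
  have "negligible ({q. (1, 1) \<bullet> q = 0} \<union> {q. (1, -1) \<bullet> q = (0 :: real)} :: (real \<times> real) set)"
    by (intro negligible_Un negligible_hyperplane) (auto simp: prod_eq_iff)
  then have "AE q in lebesgue. q \<notin> ({q. (1, 1) \<bullet> q = 0} \<union> {q. (1, -1) \<bullet> q = (0 :: real)} :: (real \<times> real) set)"
    unfolding negligible_iff_null_sets by (rule AE_not_in)
  then have "AE q :: real \<times> real in lebesgue. (fst q)\<^sup>2 \<noteq> (snd q)\<^sup>2"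
    by eventually_elim (auto simp: inner_prod_def power2_eq_iff)
  then show ?thesis
    by (simp add: AE_completion_iff)
qed

section \<open>Lindhard functions of the two states\<close>

lemma lindhard_eq:
  "lindhard m n \<eta> \<nu> \<Omega> q =
     m / (2 * pi) * (\<Sum>\<alpha>=1..4. polarization (8 * pi * (\<nu> \<alpha> * n) / m) (dispersion m \<eta> \<alpha> q) \<Omega>)"
  unfolding lindhard_def polarization_def by (simp add: mult.commute)

lemma lindhard_measurable [measurable]:
  assumes [measurable]: "s \<in> borel_measurable M" "q \<in> M \<rightarrow>\<^sub>M borel"
  shows "(\<lambda>x. lindhard m n \<eta> \<nu> (s x) (q x)) \<in> borel_measurable M"
proof -
  have [measurable]: "(\<lambda>x. fst (q x)) \<in> borel_measurable M" "(\<lambda>x. snd (q x)) \<in> borel_measurable M"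
    using assms(2) by (auto simp: borel_prod[symmetric])
  show ?thesis
    unfolding lindhard_eq dispersion_def by measurable
qed

lemma sum_1_4: "(\<Sum>\<alpha>=1..4::nat. f \<alpha>) = f 1 + f 2 + f 3 + (f 4 :: real)"
  by (simp add: numeral_eq_Suc)

text \<open>Averaging over the rotation pairs each of the two dispersions once with each of the
  densities belonging to (1 + \<zeta>) / 4 and (1 - \<zeta>) / 4, which is exactly the
  spin-polarized filling.\<close>

lemma lindhard_pSP_eq_mean:
  assumes "\<eta> > 0"
  shows "lindhard m n \<eta> (pSP \<zeta>) \<Omega> q
    = (lindhard m n \<eta> (pVP \<zeta>) \<Omega> q + lindhard m n \<eta> (pVP \<zeta>) \<Omega> (C4 q)) / 2"
  using assms unfolding lindhard_eq sum_1_4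
  by (simp add: pSP_def pVP_def dispersion_def anisotropy_def C4_def real_sqrt_divide algebra_simps)

lemma eventually_lindhard_pVP_C4_neq:
  assumes "m > 0" "n > 0" "\<eta> > 0" "\<eta> \<noteq> 1" "\<zeta> \<noteq> 0" and q: "(fst q)\<^sup>2 \<noteq> (snd q)\<^sup>2"
  shows "eventually (\<lambda>\<Omega>. lindhard m n \<eta> (pVP \<zeta>) \<Omega> q \<noteq> lindhard m n \<eta> (pVP \<zeta>) \<Omega> (C4 q)) at_top"
proof -
  define X Y where "X = dispersion m \<eta> 1 q" and "Y = dispersion m \<eta> 3 q"
  define c c' where "c = 8 * pi * ((1 + \<zeta>) / 4 * n) / m" and "c' = 8 * pi * ((1 - \<zeta>) / 4 * n) / m"
  have r: "sqrt \<eta> > 0" "sqrt \<eta> \<noteq> 1"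
    using assms by auto
  \<comment> \<open>Off the diagonals \<open>q\<close> is nonzero, so both dispersions are positive,
    as the asymptotic expansion requires.\<close>
  have "0 < (fst q)\<^sup>2 * x + (snd q)\<^sup>2 * y" if "x > 0" "y > 0" for x y
  proof (cases "fst q = 0")
    case True
    with q that show ?thesis by simp
  next
    case False
    with that show ?thesis by (intro add_pos_nonneg) auto
  qed
  from this[of "1 / sqrt \<eta>" "sqrt \<eta>"] this[of "sqrt \<eta>" "1 / sqrt \<eta>"]
  have XY: "X > 0" "Y > 0"
    using assms r(1) by (simp_all add: X_def Y_def dispersion_def anisotropy_def real_sqrt_divide)
  have "2 * m * X = (fst q)\<^sup>2 * (1 / sqrt \<eta>) + (snd q)\<^sup>2 * sqrt \<eta>"
    and "2 * m * Y = (fst q)\<^sup>2 * sqrt \<eta> + (snd q)\<^sup>2 * (1 / sqrt \<eta>)"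
    using assms(1) by (simp_all add: X_def Y_def dispersion_def anisotropy_def real_sqrt_divide)
  then have "2 * m * (X - Y) = ((fst q)\<^sup>2 - (snd q)\<^sup>2) * (1 / sqrt \<eta> - sqrt \<eta>)"
    by (simp only: right_diff_distrib left_diff_distrib)
  moreover have "1 / sqrt \<eta> \<noteq> sqrt \<eta>"
    using assms by (auto simp: field_simps)
  ultimately have ne: "X \<noteq> Y"
    using q by auto
  have disp: "dispersion m \<eta> 1 q = X" "dispersion m \<eta> 2 q = X"
      "dispersion m \<eta> 3 q = Y" "dispersion m \<eta> 4 q = Y"
      "dispersion m \<eta> 1 (C4 q) = Y" "dispersion m \<eta> 2 (C4 q) = Y"
      "dispersion m \<eta> 3 (C4 q) = X" "dispersion m \<eta> 4 (C4 q) = X"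
    using assms by (auto simp: X_def Y_def dispersion_def anisotropy_def C4_def real_sqrt_divide)
  let ?L = "lindhard m n \<eta> (pVP \<zeta>)"
  have "?L \<Omega> q - ?L \<Omega> (C4 q) = m / pi *
     (polarization c X \<Omega> + polarization c' Y \<Omega> - polarization c Y \<Omega> - polarization c' X \<Omega>)" for \<Omega>
    unfolding lindhard_eq sum_1_4 disp
    by (simp add: pVP_def c_def c'_def algebra_simps)
  then have "\<Omega>\<^sup>2 * (?L \<Omega> q - ?L \<Omega> (C4 q)) = m / pi *
     (\<Omega>\<^sup>2 * polarization c X \<Omega> + \<Omega>\<^sup>2 * polarization c' Y \<Omega> - \<Omega>\<^sup>2 * polarization c Y \<Omega> - \<Omega>\<^sup>2 * polarization c' X \<Omega>)" for \<Omega>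
    by (simp only:) (simp add: algebra_simps)
  then have "((\<lambda>\<Omega>. \<Omega>\<^sup>2 * (?L \<Omega> q - ?L \<Omega> (C4 q))) \<longlongrightarrow>
      m / pi * (c * X / 2 + c' * Y / 2 - c * Y / 2 - c' * X / 2)) at_top"
    by (simp only:) (intro tendsto_intros tendsto_scaled_polarization XY)
  \<comment> \<open>The limit factors into a density difference, nonzero because \<zeta> is, and a
    dispersion difference, nonzero off the diagonals because \<eta> differs from 1.\<close>
  moreover have "m / pi * (c * X / 2 + c' * Y / 2 - c * Y / 2 - c' * X / 2) = m / pi * ((c - c') * (X - Y) / 2)"
    by (simp add: field_simps)
  moreover have "c - c' \<noteq> 0"
    using assms by (simp add: c_def c'_def field_simps)
  ultimately have lim: "((\<lambda>\<Omega>. \<Omega>\<^sup>2 * (?L \<Omega> q - ?L \<Omega> (C4 q))) \<longlongrightarrow> m / pi * ((c - c') * (X - Y) / 2)) at_top"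
    and nz: "m / pi * ((c - c') * (X - Y) / 2) \<noteq> 0"
    using ne assms(1) by simp_all
  from tendsto_imp_eventually_ne[OF lim nz]
  show ?thesis
    by eventually_elim auto
qed

section \<open>Comparison of the ring integrals\<close>

lemma ring_integral_lborel:
  assumes "AE q in lborel. v q = w q"
  shows "ring_integral m n \<eta> v \<nu> =
     (\<integral>\<^sup>+\<Omega>\<in>{0<..}. (\<integral>\<^sup>+q. ennreal ((w q)\<^sup>2 * (lindhard m n \<eta> \<nu> \<Omega> q)\<^sup>2) \<partial>lborel) \<partial>lborel)"
proof -
  have "(\<integral>\<^sup>+q. ennreal ((v q)\<^sup>2 * (lindhard m n \<eta> \<nu> \<Omega> q)\<^sup>2) \<partial>lborel)
      = (\<integral>\<^sup>+q. ennreal ((w q)\<^sup>2 * (lindhard m n \<eta> \<nu> \<Omega> q)\<^sup>2) \<partial>lborel)" for \<Omega>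
    using assms by (intro nn_integral_cong_AE) (auto elim: eventually_mono)
  then show ?thesis
    unfolding ring_integral_def nn_integral_completion by simp
qed

text \<open>The parallelogram identity is applied at each fixed frequency. Stating the result as a
  sum avoids subtraction in the extended nonnegative reals.\<close>

lemma ring_integral_pVP_eq:
  fixes m n \<eta> \<zeta> :: real and w :: "real \<times> real \<Rightarrow> real"
  assumes "\<eta> > 0" and [measurable]: "w \<in> borel_measurable borel"
    and C4: "AE q in lborel. w (C4 q) = w q"
  defines "L \<equiv> lindhard m n \<eta> (pVP \<zeta>)"
  shows "ring_integral m n \<eta> w (pVP \<zeta>) = ring_integral m n \<eta> w (pSP \<zeta>) +
    (\<integral>\<^sup>+\<Omega>\<in>{0<..}. (\<integral>\<^sup>+q. ennreal ((w q)\<^sup>2 * ((L \<Omega> q - L \<Omega> (C4 q)) / 2)\<^sup>2) \<partial>lborel) \<partial>lborel)"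
proof -
  have [measurable]: "L \<Omega> \<in> borel_measurable borel" for \<Omega>
    unfolding L_def by measurable
  let ?S = "lindhard m n \<eta> (pSP \<zeta>)"
  have pointwise: "(\<integral>\<^sup>+q. ennreal ((w q)\<^sup>2 * (L \<Omega> q)\<^sup>2) \<partial>lborel)
    = (\<integral>\<^sup>+q. ennreal ((w q)\<^sup>2 * (?S \<Omega> q)\<^sup>2) \<partial>lborel)
      + (\<integral>\<^sup>+q. ennreal ((w q)\<^sup>2 * ((L \<Omega> q - L \<Omega> (C4 q)) / 2)\<^sup>2) \<partial>lborel)" (is "?I = ?J + ?K") for \<Omega>
  proof -
    have "?I = (\<integral>\<^sup>+q. ennreal ((w q)\<^sup>2 * (L \<Omega> q)\<^sup>2) \<partial>distr lborel borel C4)"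
      unfolding lborel_distr_C4 ..
    also have "\<dots> = (\<integral>\<^sup>+q. ennreal ((w (C4 q))\<^sup>2 * (L \<Omega> (C4 q))\<^sup>2) \<partial>lborel)"
      by (subst nn_integral_distr) simp_all
    also have "\<dots> = (\<integral>\<^sup>+q. ennreal ((w q)\<^sup>2 * (L \<Omega> (C4 q))\<^sup>2) \<partial>lborel)"
      using C4 by (intro nn_integral_cong_AE) (auto elim: eventually_mono)
    finally have "?I + ?I = (\<integral>\<^sup>+q. ennreal ((w q)\<^sup>2 * (L \<Omega> q)\<^sup>2 + (w q)\<^sup>2 * (L \<Omega> (C4 q))\<^sup>2) \<partial>lborel)"
      by (simp add: nn_integral_add)
    also have "\<dots> = (\<integral>\<^sup>+q. ennreal (2 * ((w q)\<^sup>2 * (?S \<Omega> q)\<^sup>2 + (w q)\<^sup>2 * ((L \<Omega> q - L \<Omega> (C4 q)) / 2)\<^sup>2)) \<partial>lborel)"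
      unfolding lindhard_pSP_eq_mean[OF \<open>\<eta> > 0\<close>] L_def[symmetric]
      by (intro nn_integral_cong arg_cong[where f = ennreal])
        (simp add: power2_eq_square field_simps)
    also have "\<dots> = 2 * (?J + ?K)"
      by (simp add: ennreal_mult nn_integral_cmult nn_integral_add)
    finally have "2 * ?I = 2 * (?J + ?K)"
      by (simp only: mult_2)
    \<comment> \<open>The factor 2 may be cancelled because it is neither zero nor infinite.\<close>
    then show ?thesis
      by (subst (asm) ennreal_mult_cancel_left) simp
  qed
  show ?thesis
    unfolding ring_integral_lborel[of w w, simplified] L_def[symmetric] pointwise distrib_right
    unfolding L_def by (intro nn_integral_add) measurable
qed

lemma nn_integral_lborel_pos_of_eventually:
  fixes f :: "real \<Rightarrow> ennreal"
  assumes [measurable]: "f \<in> borel_measurable borel" and "eventually (\<lambda>x. f x \<noteq> 0) at_top"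
  shows "(\<integral>\<^sup>+x\<in>{0<..}. f x \<partial>lborel) \<noteq> 0"
proof
  assume "(\<integral>\<^sup>+x\<in>{0<..}. f x \<partial>lborel) = 0"
  then have AE: "AE x in lborel. f x * indicator {0<..} x = 0"
    by (subst (asm) nn_integral_0_iff_AE) simp_all
  obtain b where b: "\<And>x. x \<ge> b \<Longrightarrow> f x \<noteq> 0"
    using assms(2) by (auto simp: eventually_at_top_linorder)
  \<comment> \<open>The maximum keeps the interval inside the positive half-line, where the
    indicator is 1.\<close>
  define c where "c = max b 1"
  have "AE x in lborel. x \<notin> {c..c + 1}"
    using AE
  proof eventually_elim
    case (elim x)
    then show ?case
      using b[of x] by (auto simp: c_def indicator_def split: if_splits)
  qed
  then have "emeasure lborel {c..c + 1} = 0"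
    by (subst (asm) AE_iff_measurable[of "{c..c + 1}"]) auto
  then show False
    by simp
qed

text \<open>The frequency beyond which the integrand is nonzero depends on \<open>q\<close>.
  Tonelli's theorem therefore moves the frequency integral inside, so that it can be handled for
  each momentum separately.\<close>

lemma nn_integral_gap_pos:
  fixes m n \<eta> \<zeta> :: real and w :: "real \<times> real \<Rightarrow> real"
  assumes "m > 0" "n > 0" "\<eta> > 0" "\<eta> \<noteq> 1" "\<zeta> \<noteq> 0"
    and [measurable]: "w \<in> borel_measurable borel"
    and nz: "\<not> (AE q in lborel. w q = 0)"
  defines "L \<equiv> lindhard m n \<eta> (pVP \<zeta>)"
  shows "(\<integral>\<^sup>+\<Omega>\<in>{0<..}. (\<integral>\<^sup>+q. ennreal ((w q)\<^sup>2 * ((L \<Omega> q - L \<Omega> (C4 q)) / 2)\<^sup>2) \<partial>lborel) \<partial>lborel) \<noteq> 0"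
proof
  let ?g = "\<lambda>\<Omega> q. ennreal ((w q)\<^sup>2 * ((L \<Omega> q - L \<Omega> (C4 q)) / 2)\<^sup>2)"
  have gq[measurable]: "(\<lambda>\<Omega>. ?g \<Omega> q) \<in> borel_measurable borel" for q
    unfolding L_def by measurable
  assume "(\<integral>\<^sup>+\<Omega>\<in>{0<..}. (\<integral>\<^sup>+q. ?g \<Omega> q \<partial>lborel) \<partial>lborel) = 0"
  also have "(\<integral>\<^sup>+\<Omega>\<in>{0<..}. (\<integral>\<^sup>+q. ?g \<Omega> q \<partial>lborel) \<partial>lborel)
      = (\<integral>\<^sup>+\<Omega>. (\<integral>\<^sup>+q. ?g \<Omega> q * indicator {0<..} \<Omega> \<partial>lborel) \<partial>lborel)"
    unfolding L_def by (intro nn_integral_cong nn_integral_multc[symmetric]) measurable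
  also have "\<dots> = (\<integral>\<^sup>+q. (\<integral>\<^sup>+\<Omega>\<in>{0<..}. ?g \<Omega> q \<partial>lborel) \<partial>lborel)"
    unfolding L_def by (intro lborel_pair.Fubini'[symmetric]) measurable
  finally have "AE q in lborel. (\<integral>\<^sup>+\<Omega>\<in>{0<..}. ?g \<Omega> q \<partial>lborel) = 0"
    unfolding L_def by (subst (asm) nn_integral_0_iff_AE) simp_all
  with AE_lborel_off_diagonals have "AE q in lborel. w q = 0"
  proof eventually_elim
    case (elim q)
    show ?case
    proof (rule ccontr)
      assume w: "w q \<noteq> 0"
      have "eventually (\<lambda>\<Omega>. ?g \<Omega> q \<noteq> 0) at_top"
        using eventually_lindhard_pVP_C4_neq[OF assms(1-5) elim(1)]
        unfolding L_def[symmetric]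
        by eventually_elim (use w in \<open>simp add: ennreal_eq_0_iff not_le\<close>)
      from nn_integral_lborel_pos_of_eventually[OF gq this] show False
        using elim(2) by contradiction
    qed
  qed
  with nz show False ..
qed

theorem mainTheorem2:
  fixes m n_el \<eta> \<zeta> :: real and v :: "real \<times> real \<Rightarrow> real"
  assumes "m > 0" and "n_el > 0" and "\<eta> > 0" and "\<eta> \<noteq> 1"
    and "0 < \<zeta>" and "\<zeta> \<le> 1"
    and "v \<in> borel_measurable (lebesgue_on (- {0}))"
    and "\<And>q. q \<noteq> 0 \<Longrightarrow> v (C4 q) = v q"
    and "\<not> (AE q in lebesgue. v q = 0)"
    and "ring_integral m n_el \<eta> v (pVP \<zeta>) < \<infinity>"
    and "ring_integral m n_el \<eta> v (pSP \<zeta>) < \<infinity>"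
  shows "ring_energy m n_el \<eta> v (pVP \<zeta>) < ring_energy m n_el \<eta> v (pSP \<zeta>)"
proof -
  \<comment> \<open>Extending by zero at the origin gives a Lebesgue measurable function on the
    whole plane, which agrees almost everywhere with a Borel function \<open>w\<close>.\<close>
  have "(\<lambda>q. if q \<in> - {0} then v q else 0) \<in> borel_measurable lebesgue"
    using assms(7) by (subst borel_measurable_if) auto
  from completion_ex_borel_measurable_real[OF this]
  obtain w where w: "w \<in> borel_measurable borel"
    and w_eq: "AE q in lborel. (if q \<in> - {0} then v q else 0) = w q"
    by auto
  have vw: "AE q in lborel. v q = w q"
    using w_eq AE_lborel_off_diagonals by eventually_elim (auto split: if_splits)
  have C4: "AE q in lborel. w (C4 q) = w q"
    using vw AE_lborel_C4[OF vw] AE_lborel_off_diagonals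
  proof eventually_elim
    case (elim q)
    then show ?case
      using assms(8)[of q] by (cases "q = 0") auto
  qed
  have nz: "\<not> (AE q in lborel. w q = 0)"
  proof
    assume "AE q in lborel. w q = 0"
    then have "AE q in lborel. v q = 0"
      using vw by eventually_elim simp
    then show False
      using assms(9) by (simp add: AE_completion_iff)
  qed
  have I: "ring_integral m n_el \<eta> v \<nu> = ring_integral m n_el \<eta> w \<nu>" for \<nu>
    using ring_integral_lborel[OF vw] ring_integral_lborel[of w w] by simp
  let ?G = "\<integral>\<^sup>+\<Omega>\<in>{0<..}. (\<integral>\<^sup>+q. ennreal ((w q)\<^sup>2 * ((lindhard m n_el \<eta> (pVP \<zeta>) \<Omega> q
      - lindhard m n_el \<eta> (pVP \<zeta>) \<Omega> (C4 q)) / 2)\<^sup>2) \<partial>lborel) \<partial>lborel"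
  have "?G \<noteq> 0"
    using assms nz w by (intro nn_integral_gap_pos) auto
  \<comment> \<open>Adding a nonzero gap is strict only because the spin-polarized integral is
    finite.\<close>
  then have "ring_integral m n_el \<eta> v (pSP \<zeta>) < ring_integral m n_el \<eta> v (pSP \<zeta>) + ?G"
    using assms(11) ennreal_add_left_cancel_less[of "ring_integral m n_el \<eta> v (pSP \<zeta>)" 0 ?G]
    by (simp add: zero_less_iff_neq_zero)
  also have "\<dots> = ring_integral m n_el \<eta> v (pVP \<zeta>)"
    unfolding I by (rule ring_integral_pVP_eq[symmetric, OF assms(3) w C4])
  finally have "enn2real (ring_integral m n_el \<eta> v (pSP \<zeta>)) < enn2real (ring_integral m n_el \<eta> v (pVP \<zeta>))"
    using assms(10) by (simp add: enn2real_less_iff)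
  \<comment> \<open>The negative prefactor of the energy reverses the inequality.\<close>
  then show ?thesis
    unfolding ring_energy_def by (simp add: divide_strict_right_mono)
qed

end
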